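(* Let $\mathfrak A$ be a finite-dimensional unital associative algebra over $\mathbb C$ and let $F$ be a linear functional on $\mathfrak A$ such that the matrix $A_F$ has rank $1$ and $F(1)=1$. Then $F$ is multiplicative, i.e. $F(ab)=F(a)F(b)$ for all $a,b\in\mathfrak A$.
   Context: $A_F$ is the matrix $(F(e_ie_j))_{i,j}$ of the bilinear form $(x,y)\mapsto F(xy)$ in a basis $\{e_i\}$ of $\mathfrak A$. *)

theory Defs
  imports "HOL-Analysis.Cartesian_Space" Complex_Main
begin

text \<open>
  The carrier is the whole type. The sort \<open>{ring, monoid_mult}\<close> is that of unital associative
  rings without the requirement \<open>0 \<noteq> 1\<close> that \<open>ring_1\<close> would impose.
\<close>

locale complex_algebra = vector_space scale
  for scale :: "complex \<Rightarrow> 'a :: {ring, monoid_mult} \<Rightarrow> 'a" (infixr \<open>*\<^sub>C\<close> 75) +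
  assumes scale_mult_left: "(c *\<^sub>C x) * y = c *\<^sub>C (x * y)"
    and scale_mult_right: "x * (c *\<^sub>C y) = c *\<^sub>C (x * y)"
begin

text \<open>A basis indexed by a finite type; its existence makes the algebra finite-dimensional.\<close>

definition indexed_basis :: "('n :: finite \<Rightarrow> 'a) \<Rightarrow> bool" where
  "indexed_basis e \<longleftrightarrow> inj e \<and> independent (range e) \<and> span (range e) = UNIV"

end

definition form_matrix ::
    "('a :: times \<Rightarrow> complex) \<Rightarrow> ('n :: finite \<Rightarrow> 'a) \<Rightarrow> complex ^ 'n ^ 'n" where
  "form_matrix F e = (\<chi> i j. F (e i * e j))"

end

theory Submission
  imports Defs
begin

text \<open>
  A bilinear form whose matrix has rank one is a product of two functionals of one variable:
  \<open>F (a * b) = f a * g b\<close>. Since the algebra has a unit and the form comes from its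
  multiplication, both factors are recovered from \<open>F\<close>: putting \<open>b = 1\<close> or \<open>a = 1\<close> gives
  \<open>F a = f a * g 1\<close> and \<open>F b = f 1 * g b\<close>. Hence
  \<open>F a * F b = (f 1 * g 1) * (f a * g b) = F 1 * F (a * b)\<close>, and \<open>F 1 = 1\<close> finishes the proof.

  The factorisation is \<open>rank_one_entries\<close> on the level of matrices, and
  \<open>complex_algebra.rank_one_form_factors\<close> carries it to all elements by expanding them in the
  basis.
\<close>

text \<open>The rows span a line; \<open>v\<close> generates it and \<open>u i\<close> is the coordinate of row \<open>i\<close> on it.\<close>

lemma rank_one_entries:
  fixes A :: "'k::field ^ 'n ^ 'm"
  assumes "rank A = 1"
  obtains u v where "\<And>i j. A $ i $ j = u i * v $ j"
proof -
  obtain B where B: "rows A \<subseteq> vec.span B" "card B = vec.dim (rows A)"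
    by (meson vec.basis_exists)
  then have "card B = 1"
    using assms by (simp add: row_rank_def_gen)
  then obtain v where "B = {v}"
    by (auto simp: card_1_singleton_iff)
  then have "\<exists>t. row i A = t *s v" for i
    using B(1) by (auto simp: rows_def vec.span_singleton)
  then obtain u where u: "\<And>i. row i A = u i *s v"
    by metis
  show ?thesis
  proof
    fix i j
    have "A $ i $ j = row i A $ j"
      by (simp add: row_def)
    then show "A $ i $ j = u i * v $ j"
      by (simp add: u)
  qed
qed

context complex_algebra
begin

lemma indexed_basis_expansion:
  assumes "indexed_basis e"
  obtains c where "\<And>x. x = (\<Sum>i\<in>UNIV. c x i *\<^sub>C e i)"
proof -
  have inj: "inj e" and span: "span (range e) = UNIV"
    using assms by (auto simp: indexed_basis_def)
  have "\<exists>t. x = (\<Sum>i\<in>UNIV. t i *\<^sub>C e i)" for x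
  proof -
    have "x \<in> range (\<lambda>t. \<Sum>v\<in>range e. t v *\<^sub>C v)"
      using span span_finite[of "range e"] by simp
    then obtain t where "x = (\<Sum>v\<in>range e. t v *\<^sub>C v)"
      by auto
    also have "\<dots> = (\<Sum>i\<in>UNIV. t (e i) *\<^sub>C e i)"
      by (simp add: sum.reindex[OF inj])
    finally show ?thesis
      by (rule exI[of _ "\<lambda>i. t (e i)"])
  qed
  then show ?thesis
    using that by metis
qed

text \<open>
  By bilinearity, the double sum of \<open>F (e i * e j) = u i * w j\<close> weighted by the coordinates of
  \<open>a\<close> and \<open>b\<close> is the product of the two single sums.
\<close>

lemma rank_one_form_factors:
  assumes "indexed_basis e" and "Vector_Spaces.linear scale (*) F"
    and "rank (form_matrix F e) = 1"
  obtains f g where "\<And>a b. F (a * b) = f a * g b"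
proof -
  interpret F: Vector_Spaces.linear scale "(*)" F
    by fact
  obtain c where c: "\<And>x. x = (\<Sum>i\<in>UNIV. c x i *\<^sub>C e i)"
    using indexed_basis_expansion[OF assms(1)] by blast
  obtain u v where "\<And>i j. form_matrix F e $ i $ j = u i * v $ j"
    using rank_one_entries[OF assms(3)] by blast
  then have uv: "F (e i * e j) = u i * v $ j" for i j
    by (simp add: form_matrix_def)
  show ?thesis
  proof
    fix a b
    have "a * b = (\<Sum>i\<in>UNIV. c a i *\<^sub>C e i) * (\<Sum>j\<in>UNIV. c b j *\<^sub>C e j)"
      using c by metis
    also have "\<dots> = (\<Sum>i\<in>UNIV. \<Sum>j\<in>UNIV. c b j *\<^sub>C c a i *\<^sub>C (e i * e j))"
      by (simp only: sum_product scale_mult_left scale_mult_right)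
    finally have "F (a * b) = (\<Sum>i\<in>UNIV. \<Sum>j\<in>UNIV. c b j * (c a i * (u i * v $ j)))"
      by (simp only: F.sum F.scale uv)
    also have "\<dots> = (\<Sum>i\<in>UNIV. c a i * u i) * (\<Sum>j\<in>UNIV. c b j * v $ j)"
      by (simp add: sum_product mult_ac)
    finally show "F (a * b) = (\<Sum>i\<in>UNIV. c a i * u i) * (\<Sum>j\<in>UNIV. c b j * v $ j)" .
  qed
qed

end

theorem theorem10:
  fixes scale :: "complex \<Rightarrow> 'a :: {ring, monoid_mult} \<Rightarrow> 'a"
    and e :: "'n :: finite \<Rightarrow> 'a"
    and F :: "'a \<Rightarrow> complex"
  assumes "complex_algebra scale"
    and "complex_algebra.indexed_basis scale e"
    and "Vector_Spaces.linear scale (*) F"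
    and "rank (form_matrix F e) = 1"
    and "F 1 = 1"
  shows "\<forall>a b. F (a * b) = F a * F b"
proof (intro allI)
  fix a b
  obtain f g where fg: "\<And>a b. F (a * b) = f a * g b"
    using complex_algebra.rank_one_form_factors[OF assms(1-4)] by blast
  have "F a * F b = (f a * g 1) * (f 1 * g b)"
    using fg[of a 1] fg[of 1 b] by simp
  also have "\<dots> = (f 1 * g 1) * (f a * g b)"
    by (simp add: mult_ac)
  also have "\<dots> = F (a * b)"
    using fg[of 1 1] fg[of a b] \<open>F 1 = 1\<close> by simp
  finally show "F (a * b) = F a * F b" ..
qed

end
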